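(* Let $X\subseteq\mathbb{R}^d$ be nonempty, closed and convex, let $f\colon\mathbb{R}^d\to\mathbb{R}$ be convex (not necessarily smooth), and let $\mathbf{x}^\star\in X$ be a minimizer of $f$ over $X$. Let $\mathbf{x}_0$ be a given initial point, and let $\widetilde{\nabla}f$ be a stochastic oracle satisfying, for all $\mathbf{x}\in\mathbb{R}^d$, $$\mathbb{E}[\widetilde{\nabla} f(\mathbf{x})]\in\partial f(\mathbf{x}),\qquad \mathbb{E}\|\widetilde{\nabla} f(\mathbf{x})\|^2\le B^2\|\mathbf{x}-\mathbf{x}_0\|^2+G^2,$$ with finite constants $B>0$, $G\ge 0$. Let $\{\mathbf{x}_k\}$ be generated for $k\ge 0$ by $$\mathbf{x}_{k+1}=P_X\big(\beta_k\mathbf{x}_0+(1-\beta_k)\mathbf{x}_k-\tau_k\widetilde{\nabla}f(\mathbf{x}_k)\big),\qquad \beta_k=\frac{1}{k+2},\quad \tau_k=\frac{\sqrt{k+1}}{\sqrt{6}\,B\,(k+2)}.$$ Then for any $k\ge 0$ we have the last-iterate guarantee $$\mathbb{E}[f(\mathbf{x}_k)]-f(\mathbf{x}^\star)\le\frac{2\sqrt{6}\,B\,(1+\log(k+2))}{\sqrt{k+1}}\left(3\|\mathbf{x}_0-\mathbf{x}^\star\|^2+\frac{G^2}{B^2}\right)=\widetilde{O}\left(\frac{1}{\sqrt{k}}\right).$$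
   Context: $\|\cdot\|$ is the Euclidean norm, $\partial f$ the convex subdifferential, and $P_X(\mathbf{x})=\arg\min_{\mathbf{y}\in X}\|\mathbf{y}-\mathbf{x}\|^2$ the Euclidean projection. The initial point $\mathbf{x}_0$ is deterministic. At each iteration the oracle is called with fresh randomness independent of the past; thus, with $\mathbb{E}_k$ the expectation conditioned on the $\sigma$-algebra generated by $\mathbf{x}_1,\dots,\mathbf{x}_k$, one has $\mathbb{E}_k[\widetilde{\nabla}f(\mathbf{x}_k)]\in\partial f(\mathbf{x}_k)$ and $\mathbb{E}_k\|\widetilde{\nabla}f(\mathbf{x}_k)\|^2\le B^2\|\mathbf{x}_k-\mathbf{x}_0\|^2+G^2$. $\log$ is the natural logarithm, and $\widetilde{O}$ hides factors polylogarithmic in $k$ and constants independent of $k$ (as $k\to\infty$). *)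

theory Defs
  imports "HOL-Probability.Probability" "HOL-Library.Landau_Symbols"
begin

definition subdifferential :: "('a::real_inner \<Rightarrow> real) \<Rightarrow> 'a \<Rightarrow> 'a set"
  where "subdifferential f x = {v. \<forall>y. f x + v \<bullet> (y - x) \<le> f y}"

(* Asymptotic upper bound up to a factor polylogarithmic in k. *)
definition soft_bigo :: "(nat \<Rightarrow> real) \<Rightarrow> (nat \<Rightarrow> real) set"
  where "soft_bigo g = {h. \<exists>p::nat. h \<in> O(\<lambda>k. ln (real k) ^ p * g k)}"

(* The oracle is a map g from a query point and a random seed with law P to an
   estimate of a subgradient. The explicit integrability conditions make the
   expectations meaningful, as Bochner integrals of non-integrable functions are 0. *)
definition stochastic_subgradient_oracle ::
    "('a::euclidean_space \<Rightarrow> real) \<Rightarrow> 'a \<Rightarrow> real \<Rightarrow> real \<Rightarrow> 's measure \<Rightarrow> ('a \<Rightarrow> 's \<Rightarrow> 'a) \<Rightarrow> bool"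
  where "stochastic_subgradient_oracle f x0 B G P g \<longleftrightarrow>
    prob_space P \<and>
    (\<lambda>(x, s). g x s) \<in> borel_measurable (borel \<Otimes>\<^sub>M P) \<and>
    (\<forall>x. integrable P (g x) \<and>
         integrable P (\<lambda>s. (norm (g x s))\<^sup>2) \<and>
         (LINT s|P. g x s) \<in> subdifferential f x \<and>
         (LINT s|P. (norm (g x s))\<^sup>2) \<le> B\<^sup>2 * (norm (x - x0))\<^sup>2 + G\<^sup>2)"

end

theory Submission imports Defs "HOL-Real_Asymp.Real_Asymp"
begin

text \<open>Write \<open>D = norm (x0 - xstar)\<close>, \<open>w k = sqrt (k + 1)\<close> and \<open>c = 2 / (sqrt 6 * B)\<close>.
The oracle noise may grow like \<open>B\<^sup>2 * norm (x - x0)\<^sup>2\<close>, and the anchor \<open>\<beta> k *\<^sub>R x0\<close> is there to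
pay for it. By the parallelogram-type identity for convex combinations, anchoring creates a term
\<open>- \<beta> k * (1 - \<beta> k) * norm (x k - x0)\<^sup>2\<close>. Half of it absorbs the cross term between anchor and
gradient (\<open>closest_point_halpern_step\<close>); the step size is tuned so that the other half is exactly
\<open>3 * (\<tau> k)\<^sup>2 * B\<^sup>2 * norm (x k - x0)\<^sup>2\<close>, which is the growing part of the noise
(\<open>noise_absorbed\<close>). Only the constant \<open>G\<^sup>2\<close> survives. The seed of step \<open>k\<close> is independent of the
past, so Fubini allows to average over it first. For any comparison point \<open>z\<close> in \<open>X\<close> that depends
on the past only, multiplication by \<open>k + 2\<close> gives (\<open>one_step\<close>)

\<open>(k + 2) * E (norm (x (k + 1) - z)\<^sup>2) + c * w k * (E (f (x k)) - E (f z))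
  \<le> (k + 1) * E (norm (x k - z)\<^sup>2) + E (norm (x0 - z)\<^sup>2) + G\<^sup>2 / (2 * B\<^sup>2)\<close>.

This telescopes over \<open>k\<close> (\<open>weighted_gap_sum\<close>) and is used with two kinds of comparison point.
With \<open>z = xstar\<close> it bounds the second moments of \<open>x k - xstar\<close> uniformly in \<open>k\<close> and the
\<open>w\<close>-weighted average of the gaps \<open>E (f (x k)) - f xstar\<close> up to time \<open>N\<close> (\<open>average_gap\<close>). With
\<open>z = x j\<close>, started at \<open>k = j\<close>, where \<open>x k - z\<close> vanishes, it says that the average over \<open>{j..N}\<close>
is not much larger than the value at \<open>j\<close> (\<open>suffix_gap\<close>). Dropping \<open>j\<close> from the average over
\<open>{j..N}\<close> therefore raises the average only by a multiple of \<open>1 / (N - j)\<close>, relative to the target rate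
\<open>1 / sqrt (N + 1)\<close>; shrinking \<open>{1..N}\<close> to \<open>{N}\<close> in this way adds up to a harmonic sum, which is
the logarithm in the bound (\<open>last_iterate_from_suffix_sums\<close>).

The starting point may lie outside \<open>X\<close>. Then \<open>f x0 < f xstar\<close> is possible, and \<open>x0\<close> is no legitimate
comparison point. All sums therefore begin at \<open>k = 1\<close>, and the step from \<open>x0\<close> to \<open>x 1\<close> is
estimated separately (\<open>first_step\<close>).\<close>

section \<open>The anchored projection step\<close>


text \<open>Projecting onto \<open>X\<close> does not increase the distance to \<open>z\<close>, so only the squared distance of the
unprojected point has to be expanded. The cross term \<open>2 * t * b * (u \<bullet> (x0 - x))\<close> is completed to
the square of \<open>t *\<^sub>R u + (b / 2) *\<^sub>R (x0 - x)\<close>; this costs \<open>2 * t\<^sup>2 * norm u ^ 2\<close> and a multiple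
\<open>b\<^sup>2 / 2\<close> of \<open>norm (x - x0) ^ 2\<close>, which for \<open>b \<le> 1/2\<close> is at most half of the negative term.\<close>
lemma closest_point_halpern_step:
  fixes X :: "'a::euclidean_space set"
  assumes "closed X" "convex X" "z \<in> X" "0 \<le> b" "b \<le> 1/2"
  shows "(norm (closest_point X (b *\<^sub>R x0 + (1 - b) *\<^sub>R x - t *\<^sub>R u) - z))\<^sup>2
    \<le> (1 - b) * (norm (x - z))\<^sup>2 + b * (norm (x0 - z))\<^sup>2 - 2 * t * (u \<bullet> (x - z))
      + 3 * t\<^sup>2 * (norm u)\<^sup>2 - b * (1 - b) / 2 * (norm (x - x0))\<^sup>2"
proof -
  define y where "y = b *\<^sub>R x0 + (1 - b) *\<^sub>R x - t *\<^sub>R u"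
  define p where "p = x - z"
  define q where "q = x0 - z"
  have "dist (closest_point X y) (closest_point X z) \<le> dist y z"
    using assms by (intro closest_point_lipschitz) auto
  then have "(norm (closest_point X y - z))\<^sup>2 \<le> (norm (y - z))\<^sup>2"
    using assms by (simp add: closest_point_self dist_norm)
  also have "y - z = b *\<^sub>R q + (1 - b) *\<^sub>R p - t *\<^sub>R u"
    by (simp add: y_def p_def q_def algebra_simps)
  also have "(norm \<dots>)\<^sup>2 = (1 - b) * (norm p)\<^sup>2 + b * (norm q)\<^sup>2 - 2 * t * (u \<bullet> p)
      + 3 * t\<^sup>2 * (norm u)\<^sup>2 - b * (1 - b) / 2 * (norm (p - q))\<^sup>2
      - 2 * (norm (t *\<^sub>R u + (b / 2) *\<^sub>R (q - p)))\<^sup>2 - b * (1 - 2 * b) / 2 * (norm (p - q))\<^sup>2"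
    unfolding power2_norm_eq_inner
    by (simp add: inner_simps inner_commute power2_eq_square field_simps)
  also have "\<dots> \<le> (1 - b) * (norm p)\<^sup>2 + b * (norm q)\<^sup>2 - 2 * t * (u \<bullet> p)
      + 3 * t\<^sup>2 * (norm u)\<^sup>2 - b * (1 - b) / 2 * (norm (p - q))\<^sup>2"
  proof -
    have "0 \<le> b * (1 - 2 * b) / 2 * (norm (p - q))\<^sup>2"
      using assms by simp
    then show ?thesis by (smt (verit) zero_le_power2)
  qed
  finally show ?thesis by (simp add: y_def p_def q_def)
qed

lemma inner_le_half_squares: "u \<bullet> v \<le> ((norm u)\<^sup>2 + (norm v)\<^sup>2) / 2"
proof -
  have "0 \<le> (norm (u - v))\<^sup>2" by simp
  then show ?thesis
    unfolding power2_norm_eq_inner by (simp add: inner_simps inner_commute)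
qed

lemma power2_norm_add_le: "(norm (u + v :: 'a::real_inner))\<^sup>2 \<le> 2 * (norm u)\<^sup>2 + 2 * (norm v)\<^sup>2"
  using inner_le_half_squares[of u v]
  unfolding power2_norm_eq_inner by (simp add: inner_simps inner_commute)

text \<open>Nonnegativity of the variance of \<open>h\<close>.\<close>
lemma power2_norm_mean_le:
  fixes h :: "'s \<Rightarrow> 'a::euclidean_space"
  assumes "prob_space P" "integrable P h" "integrable P (\<lambda>s. (norm (h s))\<^sup>2)"
  shows "(norm (LINT s|P. h s))\<^sup>2 \<le> (LINT s|P. (norm (h s))\<^sup>2)"
proof -
  interpret prob_space P by fact
  define v where "v = (LINT s|P. h s)"
  have "0 \<le> (LINT s|P. (norm (h s - v))\<^sup>2)" by simp
  also have "\<dots> = (LINT s|P. (norm (h s))\<^sup>2 - 2 * (h s \<bullet> v) + (norm v)\<^sup>2)"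
    by (rule arg_cong[where f = "integral\<^sup>L P"], rule ext)
      (simp add: power2_norm_eq_inner inner_simps inner_commute)
  also have "\<dots> = (LINT s|P. (norm (h s))\<^sup>2) - 2 * (v \<bullet> v) + (norm v)\<^sup>2"
    using assms by (simp add: v_def prob_space)
  finally show ?thesis by (simp add: v_def power2_norm_eq_inner)
qed

section \<open>From suffix sums to the last term\<close>

text \<open>The worst case of this bound is \<open>i = 0\<close>, where it compares the sum with the integral of the square
root. The factor \<open>sqrt (i + n)\<close>, rather than a mean over the summation range, makes the bound
usable for all suffixes of a fixed range with the same constant.\<close>
lemma sum_sqrt_ge:
  "2 / 3 * real n * sqrt (real (i + n)) \<le> (\<Sum>k = i..<i + n. sqrt (real k + 1))"
proof (induction n)
  case (Suc n)
  \<comment> \<open>Three times the increment inequality, which after squaring is a polynomial inequality.\<close>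
  have "2 * real n * sqrt (real (i + n)) + 3 * sqrt (real (i + n) + 1)
      \<ge> 2 * (real n + 1) * sqrt (real (i + n) + 1)"
  proof (cases "n = 0")
    case False
    have "(2 * real n - 1) * sqrt (real (i + n) + 1) = sqrt ((2 * real n - 1)\<^sup>2 * (real (i + n) + 1))"
      using False by (simp add: real_sqrt_mult)
    also have "\<dots> \<le> sqrt ((2 * real n)\<^sup>2 * real (i + n))"
    proof (rule real_sqrt_le_mono)
      have "(2 * real n)\<^sup>2 * real (i + n) - (2 * real n - 1)\<^sup>2 * (real (i + n) + 1)
         = (4 * real n - 1) * real i + (3 * real n - 1)"
        by (simp add: power2_eq_square algebra_simps)
      moreover have "0 \<le> (4 * real n - 1) * real i" "0 \<le> 3 * real n - 1"
        using False by auto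
      ultimately show "(2 * real n - 1)\<^sup>2 * (real (i + n) + 1) \<le> (2 * real n)\<^sup>2 * real (i + n)"
        by linarith
    qed
    also have "\<dots> = 2 * real n * sqrt (real (i + n))"
      by (simp add: real_sqrt_mult)
    finally show ?thesis by (simp add: algebra_simps)
  qed simp
  then have "2 / 3 * real (Suc n) * sqrt (real (i + n) + 1)
      \<le> 2 / 3 * real n * sqrt (real (i + n)) + sqrt (real (i + n) + 1)"
    by (simp add: algebra_simps)
  also have "\<dots> \<le> (\<Sum>k = i..<i + Suc n. sqrt (real k + 1))"
    using Suc.IH by simp
  finally show ?case by (simp add: add_ac)
qed simp

lemma harm_le_one_plus_ln:
  assumes "n > 0" shows "harm n \<le> (1 :: real) + ln (real n)"
proof -
  obtain m where m: "n = Suc m" using assms by (cases n) auto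
  have "harm (Suc m) - ln (real (Suc m)) \<le> harm (Suc 0) - ln (real (Suc 0))"
    using decseqD[OF decseq_harm_diff_ln, of 0 m] by simp
  then show ?thesis by (simp add: m harm_def)
qed

text \<open>Let \<open>W j\<close> be the total weight of \<open>{j..N}\<close> and \<open>A j\<close> the weighted average of \<open>a\<close> over it. Since
\<open>W j * A j = w j * a j + W (j + 1) * A (j + 1)\<close>, one has
\<open>W (j + 1) * (A (j + 1) - A j) = w j * (A j - a j)\<close>. The suffix hypothesis bounds \<open>A j - a j\<close> by
\<open>K * (N + 1 - j) / W j\<close>, and \<open>w j * (N + 1 - j) \<le> W j\<close> because the weights increase. Hence
\<open>A (j + 1) - A j \<le> K / W (j + 1)\<close>, and the lower bound on \<open>W\<close> turns the sum of these increments
into a harmonic sum. The claim is the case \<open>A N = a N\<close>.\<close>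
lemma last_iterate_from_suffix_sums:
  fixes a :: "nat \<Rightarrow> real"
  assumes "N \<ge> 1" and "K0 \<ge> 0" and "K \<ge> 0"
    and avg: "(\<Sum>k = 1..N. sqrt (real k + 1) * a k) \<le> K0 * real N"
    and suffix: "\<And>j. 1 \<le> j \<Longrightarrow> j \<le> N \<Longrightarrow>
      (\<Sum>k = j..N. sqrt (real k + 1) * (a k - a j)) \<le> K * real (N + 1 - j)"
  shows "a N \<le> 3 / 2 * (K0 + K * harm (N - 1)) / sqrt (real N + 1)"
proof -
  define w where "w k = sqrt (real k + 1)" for k
  define W where "W j = (\<Sum>k = j..N. w k)" for j
  define A where "A j = (\<Sum>k = j..N. w k * a k) / W j" for j
  define r where "r = 3 / (2 * sqrt (real N + 1))"
  have w_pos: "w k > 0" for k by (simp add: w_def add_nonneg_pos)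
  have W_ge: "real (N + 1 - j) \<le> r * W j" if "j \<le> N" for j
  proof -
    have "2 / 3 * real (N + 1 - j) * sqrt (real N + 1) \<le> W j"
      using sum_sqrt_ge[of "N + 1 - j" j] that
      by (simp add: W_def w_def atLeastLessThanSuc_atLeastAtMost add_ac)
    then show ?thesis by (simp add: r_def field_simps)
  qed
  have W_pos: "W j > 0" if "j \<le> N" for j
    unfolding W_def using that w_pos by (intro sum_pos) auto
  have r_pos: "r > 0" by (simp add: r_def add_nonneg_pos)
  \<comment> \<open>The difference of harmonic numbers is the sum of \<open>1 / (N - i)\<close> over \<open>1 \<le> i < j\<close>.\<close>
  have "A j \<le> r * (K0 + K * (harm (N - 1) - harm (N - j)))" if "1 \<le> j" "j \<le> N" for j
    using that
  proof (induction j rule: dec_induct)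
    case base
    have "A 1 \<le> K0 * real N / W 1"
      using avg W_pos[of 1] \<open>N \<ge> 1\<close> by (auto simp: A_def w_def intro!: divide_right_mono)
    also have "\<dots> \<le> K0 * (r * W 1) / W 1"
      using W_ge[of 1] W_pos[of 1] \<open>N \<ge> 1\<close> \<open>K0 \<ge> 0\<close>
      by (intro divide_right_mono mult_left_mono) auto
    also have "\<dots> = r * K0"
      using W_pos[of 1] \<open>N \<ge> 1\<close> by simp
    finally show ?case by simp
  next
    case (step j)
    then have "j < N" by simp
    have Wj: "W j = w j + W (Suc j)"
      using \<open>j < N\<close> by (simp add: W_def sum.atLeast_Suc_atMost)
    have Aj: "A j * W j = w j * a j + A (Suc j) * W (Suc j)"
      using \<open>j < N\<close> W_pos[of j] W_pos[of "Suc j"] by (simp add: A_def sum.atLeast_Suc_atMost)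
    have "(A j - a j) * W j = (\<Sum>k = j..N. w k * a k) - a j * W j"
      using \<open>j < N\<close> W_pos[of j] by (simp add: A_def left_diff_distrib)
    also have "\<dots> = (\<Sum>k = j..N. w k * (a k - a j))"
      by (simp add: W_def right_diff_distrib sum_subtractf sum_distrib_left mult.commute)
    also have "\<dots> \<le> K * real (N + 1 - j)"
      using suffix[of j] step by (simp add: w_def)
    finally have gap: "(A j - a j) * W j \<le> K * real (N + 1 - j)" .
    have "w j * real (N + 1 - j) = (\<Sum>k = j..N. w j)" by simp
    also have "\<dots> \<le> W j"
      unfolding W_def by (intro sum_mono) (simp add: w_def)
    finally have w_le: "w j * real (N + 1 - j) \<le> W j" .
    have "(A (Suc j) - A j) * W (Suc j) * W j = w j * ((A j - a j) * W j)"
      using Aj Wj by algebra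
    also have "\<dots> \<le> w j * (K * real (N + 1 - j))"
      using gap w_pos[of j] by simp
    also have "\<dots> \<le> K * W j"
      using mult_left_mono[OF w_le \<open>K \<ge> 0\<close>] by (simp add: mult_ac)
    finally have inc: "(A (Suc j) - A j) * W (Suc j) \<le> K"
      using W_pos[of j] \<open>j < N\<close> by simp
    have "A (Suc j) - A j \<le> K / W (Suc j)"
      using inc W_pos[of "Suc j"] \<open>j < N\<close> by (simp add: pos_le_divide_eq)
    also have "1 / W (Suc j) \<le> r / real (N - j)"
      using W_ge[of "Suc j"] W_pos[of "Suc j"] \<open>j < N\<close> by (simp add: field_simps)
    then have "K / W (Suc j) \<le> K * (r / real (N - j))"
      using mult_left_mono[OF _ \<open>K \<ge> 0\<close>] by fastforce
    finally have "A (Suc j) \<le> A j + K * (r / real (N - j))" by simp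
    also have "\<dots> \<le> r * (K0 + K * (harm (N - 1) - harm (N - j))) + K * (r / real (N - j))"
      using step by simp
    also have "harm (N - j) = harm (N - Suc j) + 1 / real (N - j)"
      using harm_Suc[of "N - Suc j", where 'a = real] \<open>j < N\<close> by (simp add: Suc_diff_Suc inverse_eq_divide)
    finally show ?case by (simp add: algebra_simps)
  qed
  from this[of N] have "A N \<le> r * (K0 + K * harm (N - 1))"
    using \<open>N \<ge> 1\<close> by (simp add: harm_def)
  also have "A N = a N"
    using w_pos[of N] by (simp add: A_def W_def)
  finally show ?thesis by (simp add: r_def field_simps)
qed


section \<open>Averaging over a fresh seed\<close>

context prob_space
begin

text \<open>Tonelli for a variable \<open>Y\<close> with law \<open>P\<close> that is independent of \<open>Z\<close>, in the form of an upper bound: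
it replaces conditioning on \<open>Z\<close>. Independence enters as a product law, in which \<open>Z\<close> and \<open>Y\<close>
may have values in different types. Integrability of the left-hand side is part of the
conclusion, so that square integrability of the iterates can be obtained by induction.\<close>
lemma expectation_fresh_seed_le:
  fixes h :: "'b \<Rightarrow> 's \<Rightarrow> real" and P :: "'s measure"
  assumes Z [measurable]: "Z \<in> measurable M N" and Y [measurable]: "Y \<in> measurable M P"
    and law: "distr M P Y = P"
    and joint: "distr M (N \<Otimes>\<^sub>M P) (\<lambda>\<omega>. (Z \<omega>, Y \<omega>)) = distr M N Z \<Otimes>\<^sub>M P"
    and meas: "(\<lambda>(z, s). h z s) \<in> borel_measurable (N \<Otimes>\<^sub>M P)"
    and nonneg: "\<And>z s. 0 \<le> h z s"
    and int: "\<And>\<omega>. \<omega> \<in> space M \<Longrightarrow> integrable P (h (Z \<omega>))"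
    and le: "\<And>\<omega>. \<omega> \<in> space M \<Longrightarrow> (LINT s|P. h (Z \<omega>) s) \<le> r \<omega>"
    and r: "integrable M r"
  shows "integrable M (\<lambda>\<omega>. h (Z \<omega>) (Y \<omega>))"
    and "expectation (\<lambda>\<omega>. h (Z \<omega>) (Y \<omega>)) \<le> expectation r"
proof -
  interpret P: prob_space P
    using prob_space_distr[OF Y] law by simp
  note meas [measurable]
  have r_nonneg: "0 \<le> r \<omega>" if "\<omega> \<in> space M" for \<omega>
    using order_trans[OF _ le[OF that]] nonneg by simp
  have "(\<integral>\<^sup>+\<omega>. ennreal (h (Z \<omega>) (Y \<omega>)) \<partial>M)
      = (\<integral>\<^sup>+(z, s). ennreal (h z s) \<partial>distr M (N \<Otimes>\<^sub>M P) (\<lambda>\<omega>. (Z \<omega>, Y \<omega>)))"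
    by (subst nn_integral_distr) (auto simp: case_prod_beta')
  also have "\<dots> = (\<integral>\<^sup>+(z, s). ennreal (h z s) \<partial>(distr M N Z \<Otimes>\<^sub>M P))"
    by (simp only: joint)
  also have "\<dots> = (\<integral>\<^sup>+z. \<integral>\<^sup>+s. ennreal (h z s) \<partial>P \<partial>distr M N Z)"
    by (subst P.nn_integral_fst[symmetric]) auto
  also have "\<dots> = (\<integral>\<^sup>+\<omega>. \<integral>\<^sup>+s. ennreal (h (Z \<omega>) s) \<partial>P \<partial>M)"
    by (subst nn_integral_distr) auto
  also have "\<dots> \<le> (\<integral>\<^sup>+\<omega>. ennreal (r \<omega>) \<partial>M)"
  proof (rule nn_integral_mono)
    fix \<omega> assume \<omega>: "\<omega> \<in> space M"
    have "(\<integral>\<^sup>+s. ennreal (h (Z \<omega>) s) \<partial>P) = ennreal (LINT s|P. h (Z \<omega>) s)"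
      using int[OF \<omega>] nonneg by (intro nn_integral_eq_integral) auto
    then show "(\<integral>\<^sup>+s. ennreal (h (Z \<omega>) s) \<partial>P) \<le> ennreal (r \<omega>)"
      using le[OF \<omega>] by (simp add: ennreal_leI)
  qed
  also have "\<dots> = ennreal (expectation r)"
    using r r_nonneg by (intro nn_integral_eq_integral) auto
  finally have le_r: "(\<integral>\<^sup>+\<omega>. ennreal (h (Z \<omega>) (Y \<omega>)) \<partial>M) \<le> ennreal (expectation r)" .
  show int_h: "integrable M (\<lambda>\<omega>. h (Z \<omega>) (Y \<omega>))"
  proof (rule integrableI_bounded)
    show "(\<integral>\<^sup>+\<omega>. ennreal (norm (h (Z \<omega>) (Y \<omega>))) \<partial>M) < \<infinity>"
      using le_r nonneg by (simp add: le_less_trans)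
  qed measurable
  have "0 \<le> expectation r"
    using r_nonneg by (intro integral_nonneg_AE) auto
  moreover have "ennreal (expectation (\<lambda>\<omega>. h (Z \<omega>) (Y \<omega>))) \<le> ennreal (expectation r)"
    using le_r nn_integral_eq_integral[OF int_h] nonneg by simp
  ultimately show "expectation (\<lambda>\<omega>. h (Z \<omega>) (Y \<omega>)) \<le> expectation r"
    by simp
qed

end

section \<open>Setting of the iteration\<close>
locale stochastic_halpern = prob_space M
  for M :: "'w measure" +
  fixes X :: "'a::euclidean_space set"
    and f :: "'a \<Rightarrow> real"
    and x0 xstar :: 'a
    and B G :: real
    and P :: "'s measure"
    and g :: "'a \<Rightarrow> 's \<Rightarrow> 'a"
    and \<xi> :: "nat \<Rightarrow> 'w \<Rightarrow> 's"
    and x :: "nat \<Rightarrow> 'w \<Rightarrow> 'a"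
    and \<beta> \<tau> :: "nat \<Rightarrow> real"
  assumes closed_X: "closed X" and convex_X: "convex X"
    and convex_f: "convex_on UNIV f"
    and xstar_in: "xstar \<in> X" and xstar_min: "y \<in> X \<Longrightarrow> f xstar \<le> f y"
    and B_pos: "B > 0" and G_nonneg: "G \<ge> 0"
    and subgradient_oracle: "stochastic_subgradient_oracle f x0 B G P g"
    and indep_seeds: "indep_vars (\<lambda>_. P) \<xi> UNIV"
    and seed_law: "distr M P (\<xi> k) = P"
    and \<beta>_eq: "\<beta> k = 1 / (real k + 2)"
    and \<tau>_eq: "\<tau> k = sqrt (real k + 1) / (sqrt 6 * B * (real k + 2))"
    and start: "\<omega> \<in> space M \<Longrightarrow> x 0 \<omega> = x0"
    and iterate: "\<omega> \<in> space M \<Longrightarrow> x (Suc k) \<omega> =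
      closest_point X (\<beta> k *\<^sub>R x0 + (1 - \<beta> k) *\<^sub>R x k \<omega> - \<tau> k *\<^sub>R g (x k \<omega>) (\<xi> k \<omega>))"
begin

sublocale seed: prob_space P
  using subgradient_oracle by (simp add: stochastic_subgradient_oracle_def)

text \<open>By the oracle condition, \<open>mean_grad y\<close> is a subgradient of \<open>f\<close> at \<open>y\<close>; it is the conditional
expectation of the oracle output given that the query point is \<open>y\<close>.\<close>
definition mean_grad :: "'a \<Rightarrow> 'a" where
  "mean_grad y = (LINT s|P. g y s)"

definition step :: "nat \<Rightarrow> 'a \<Rightarrow> 's \<Rightarrow> 'a" where
  "step k y s = closest_point X (\<beta> k *\<^sub>R x0 + (1 - \<beta> k) *\<^sub>R y - \<tau> k *\<^sub>R g y s)"

text \<open>The problem-dependent factor of the final rate. Half of it bounds all second moments of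
\<open>x k - xstar\<close> with \<open>k \<ge> 1\<close>, and all other constants are expressed as multiples of it.\<close>
definition Q :: real where
  "Q = 3 * (norm (x0 - xstar))\<^sup>2 + G\<^sup>2 / B\<^sup>2"

lemma oracle_measurable [measurable]: "(\<lambda>(y, s). g y s) \<in> borel_measurable (borel \<Otimes>\<^sub>M P)"
  and integrable_oracle: "integrable P (g y)"
  and integrable_oracle_sq: "integrable P (\<lambda>s. (norm (g y s))\<^sup>2)"
  and oracle_sq_le: "(LINT s|P. (norm (g y s))\<^sup>2) \<le> B\<^sup>2 * (norm (y - x0))\<^sup>2 + G\<^sup>2"
  and mean_grad_subgradient: "f y + mean_grad y \<bullet> (z - y) \<le> f z"
  using subgradient_oracle by (auto simp: stochastic_subgradient_oracle_def subdifferential_def mean_grad_def)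

lemma mean_grad_sq_le: "(norm (mean_grad y))\<^sup>2 \<le> B\<^sup>2 * (norm (y - x0))\<^sup>2 + G\<^sup>2"
  using power2_norm_mean_le[OF seed.prob_space_axioms integrable_oracle integrable_oracle_sq]
    oracle_sq_le unfolding mean_grad_def by (rule order_trans)

lemma f_diff_le: "f y - f z \<le> mean_grad y \<bullet> (y - z)"
  using mean_grad_subgradient[of y z] by (simp add: inner_diff_right)

text \<open>Both signs come from the subgradient inequality, at \<open>y\<close> and at \<open>z\<close>. The resulting quadratic growth
of \<open>f\<close> makes \<open>f\<close> integrable along square-integrable random points.\<close>
lemma f_diff_abs_le:
  "\<bar>f y - f z\<bar> \<le> B\<^sup>2 * (norm (y - x0))\<^sup>2 + B\<^sup>2 * (norm (z - x0))\<^sup>2 + G\<^sup>2 + (norm (y - z))\<^sup>2"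
proof -
  have bound: "f u - f v \<le> (B\<^sup>2 * (norm (u - x0))\<^sup>2 + G\<^sup>2 + (norm (u - v))\<^sup>2) / 2" for u v
  proof -
    have "f u - f v \<le> ((norm (mean_grad u))\<^sup>2 + (norm (u - v))\<^sup>2) / 2"
      using f_diff_le inner_le_half_squares by (rule order_trans)
    also have "\<dots> \<le> (B\<^sup>2 * (norm (u - x0))\<^sup>2 + G\<^sup>2 + (norm (u - v))\<^sup>2) / 2"
      using mean_grad_sq_le by (intro divide_right_mono add_right_mono) auto
    finally show ?thesis .
  qed
  have half_le: "\<bar>u - v\<bar> \<le> a + b + c + d"
    if "0 \<le> a" "0 \<le> b" "0 \<le> c" "0 \<le> d" "u - v \<le> (a + c + d) / 2" "v - u \<le> (b + c + d) / 2"
    for a b c d u v :: real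
    using that by (intro abs_leI) (simp_all add: field_simps)
  show ?thesis
    using bound[of y z] bound[of z y] by (intro half_le) (simp_all add: norm_minus_commute)
qed

lemma X_nonempty: "X \<noteq> {}"
  using xstar_in by auto

lemma f_measurable [measurable]: "f \<in> borel_measurable borel"
  using convex_on_continuous[OF open_UNIV convex_f] by (rule borel_measurable_continuous_onI)

lemma projection_measurable [measurable]: "closest_point X \<in> borel_measurable borel"
  using continuous_on_closest_point[OF convex_X closed_X X_nonempty]
  by (rule borel_measurable_continuous_onI)

lemma step_measurable [measurable]: "(\<lambda>(y, s). step k y s) \<in> borel_measurable (borel \<Otimes>\<^sub>M P)"
  unfolding step_def case_prod_beta' by measurable

lemma x_Suc: "\<omega> \<in> space M \<Longrightarrow> x (Suc k) \<omega> = step k (x k \<omega>) (\<xi> k \<omega>)"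
  by (simp add: step_def iterate)

lemma x_in_X: "\<omega> \<in> space M \<Longrightarrow> 0 < k \<Longrightarrow> x k \<omega> \<in> X"
  by (cases k) (auto simp: iterate intro!: closest_point_in_set closed_X X_nonempty)

text \<open>The factor \<open>k + 2\<close> turns the contraction \<open>1 - \<beta> k\<close> into \<open>k + 1\<close>, the factor that belongs to the
preceding step; this makes the recursion telescope.\<close>
lemma step_sizes: "0 \<le> \<beta> k" "\<beta> k \<le> 1 / 2" "0 \<le> \<tau> k"
  "(real k + 2) * \<beta> k = 1" "(real k + 2) * (1 - \<beta> k) = real k + 1"
  "(real k + 2) * \<tau> k = sqrt (real k + 1) / (sqrt 6 * B)"
proof -
  show "0 \<le> \<beta> k" "\<beta> k \<le> 1 / 2" "0 \<le> \<tau> k"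
    using B_pos by (auto simp: \<beta>_eq \<tau>_eq)
  have "real k + 2 \<noteq> 0" by linarith
  then show "(real k + 2) * \<beta> k = 1" "(real k + 2) * (1 - \<beta> k) = real k + 1"
    "(real k + 2) * \<tau> k = sqrt (real k + 1) / (sqrt 6 * B)"
    by (simp_all add: \<beta>_eq \<tau>_eq right_diff_distrib)
qed

text \<open>The step size is the one for which the growing part of the noise equals what the anchor leaves over
in \<open>closest_point_halpern_step\<close>.\<close>
lemma noise_absorbed: "3 * (\<tau> k)\<^sup>2 * B\<^sup>2 = \<beta> k * (1 - \<beta> k) / 2"
proof -
  have nz: "real k + 2 \<noteq> 0" by linarith
  have "3 * (\<tau> k)\<^sup>2 * B\<^sup>2 = (real k + 1) / (2 * (real k + 2)\<^sup>2)"
  proof -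
    have sq: "(\<tau> k)\<^sup>2 = (real k + 1) / (6 * B\<^sup>2 * (real k + 2)\<^sup>2)"
      by (simp add: \<tau>_eq power_divide power_mult_distrib)
    have cancel: "3 * (a / (6 * B\<^sup>2 * m)) * B\<^sup>2 = a / (2 * m)" for a m :: real
      using B_pos by simp
    show ?thesis by (simp only: sq cancel)
  qed
  also have "\<dots> = \<beta> k * ((real k + 2) * (1 - \<beta> k)) / (2 * (real k + 2))"
    using step_sizes(5)[of k] by (simp add: \<beta>_eq power2_eq_square)
  also have "\<dots> = \<beta> k * (1 - \<beta> k) / 2"
  proof -
    have "b * (m * c) / (2 * m) = b * c / 2" if "m \<noteq> 0" for b c m :: real
      using that by simp
    then show ?thesis using nz by blast
  qed
  finally show ?thesis .
qed

lemma noise_le: "(real k + 2) * (3 * (\<tau> k)\<^sup>2 * G\<^sup>2) \<le> G\<^sup>2 / (2 * B\<^sup>2)"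
proof -
  have "(real k + 2) * (3 * (\<tau> k)\<^sup>2 * G\<^sup>2) = (real k + 2) * (3 * (\<tau> k)\<^sup>2 * B\<^sup>2) * (G\<^sup>2 / B\<^sup>2)"
    using B_pos by simp
  also have "\<dots> = ((real k + 2) * \<beta> k) * (1 - \<beta> k) * (G\<^sup>2 / (2 * B\<^sup>2))"
    unfolding noise_absorbed by simp
  also have "\<dots> \<le> 1 * (G\<^sup>2 / (2 * B\<^sup>2))"
    using step_sizes[of k] by (intro mult_right_mono) auto
  finally show ?thesis by simp
qed

section \<open>Expected progress of one step\<close>

text \<open>The pointwise estimate \<open>closest_point_halpern_step\<close> averaged over the seed, for fixed points. The
bound keeps the inner product with the mean gradient instead of a difference of function values: the
estimate of the first step needs the inner product, since \<open>f x0\<close> may be smaller than \<open>f xstar\<close>.\<close>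
lemma mean_step:
  assumes "z \<in> X"
  shows "integrable P (\<lambda>s. (norm (step k y s - z))\<^sup>2)"
    and "(LINT s|P. (norm (step k y s - z))\<^sup>2)
      \<le> (1 - \<beta> k) * (norm (y - z))\<^sup>2 + \<beta> k * (norm (x0 - z))\<^sup>2
        - 2 * \<tau> k * (mean_grad y \<bullet> (y - z)) + 3 * (\<tau> k)\<^sup>2 * G\<^sup>2"
proof -
  define r where "r s = (1 - \<beta> k) * (norm (y - z))\<^sup>2 + \<beta> k * (norm (x0 - z))\<^sup>2
      - 2 * \<tau> k * (g y s \<bullet> (y - z)) + 3 * (\<tau> k)\<^sup>2 * (norm (g y s))\<^sup>2
      - \<beta> k * (1 - \<beta> k) / 2 * (norm (y - x0))\<^sup>2" for s
  note [simp] = integrable_oracle integrable_oracle_sq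
  have le: "(norm (step k y s - z))\<^sup>2 \<le> r s" for s
    unfolding r_def step_def
    using closed_X convex_X assms step_sizes by (intro closest_point_halpern_step)
  have int_r: "integrable P r"
    unfolding r_def by simp
  have [measurable]: "step k y \<in> borel_measurable P"
    using measurable_compose[OF measurable_Pair1' step_measurable, of y k] by simp
  show int: "integrable P (\<lambda>s. (norm (step k y s - z))\<^sup>2)"
  proof (rule Bochner_Integration.integrable_bound[OF int_r])
    show "AE s in P. norm ((norm (step k y s - z))\<^sup>2) \<le> norm (r s)"
      using le by (auto intro!: AE_I2 order_trans[OF le])
  qed measurable
  have "(LINT s|P. (norm (step k y s - z))\<^sup>2) \<le> (LINT s|P. r s)"
    using int int_r le by (rule integral_mono)
  also have "\<dots> = (1 - \<beta> k) * (norm (y - z))\<^sup>2 + \<beta> k * (norm (x0 - z))\<^sup>2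
      - 2 * \<tau> k * (mean_grad y \<bullet> (y - z)) + 3 * (\<tau> k)\<^sup>2 * (LINT s|P. (norm (g y s))\<^sup>2)
      - \<beta> k * (1 - \<beta> k) / 2 * (norm (y - x0))\<^sup>2"
    unfolding r_def mean_grad_def by (simp add: seed.prob_space)
  also have "3 * (\<tau> k)\<^sup>2 * (LINT s|P. (norm (g y s))\<^sup>2)
      \<le> 3 * (\<tau> k)\<^sup>2 * (B\<^sup>2 * (norm (y - x0))\<^sup>2 + G\<^sup>2)"
    using oracle_sq_le by (intro mult_left_mono) auto
  also have "\<dots> = \<beta> k * (1 - \<beta> k) / 2 * (norm (y - x0))\<^sup>2 + 3 * (\<tau> k)\<^sup>2 * G\<^sup>2"
    unfolding noise_absorbed[symmetric] by (simp add: algebra_simps)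
  finally show "(LINT s|P. (norm (step k y s - z))\<^sup>2)
      \<le> (1 - \<beta> k) * (norm (y - z))\<^sup>2 + \<beta> k * (norm (x0 - z))\<^sup>2
        - 2 * \<tau> k * (mean_grad y \<bullet> (y - z)) + 3 * (\<tau> k)\<^sup>2 * G\<^sup>2"
    by simp
qed

text \<open>The random points that are functions of the first \<open>k\<close> seeds, hence measurable with respect to the
\<open>\<sigma>\<close>-algebra available when \<open>\<xi> k\<close> is drawn. Equality is required on \<open>space M\<close> only, where the
iterates are specified.\<close>
definition past :: "nat \<Rightarrow> ('w \<Rightarrow> 'a) set" where
  "past k = {z. \<exists>h \<in> borel_measurable (Pi\<^sub>M {..<k} (\<lambda>_. P)).
     \<forall>\<omega>\<in>space M. z \<omega> = h (\<lambda>i\<in>{..<k}. \<xi> i \<omega>)}"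

lemma seed_measurable [measurable]: "\<xi> k \<in> measurable M P"
  using indep_seeds by (auto simp: indep_vars_def)

lemma const_in_past: "(\<lambda>_. c) \<in> past k"
  unfolding past_def by (auto intro!: bexI[of _ "\<lambda>_. c"])

lemma x_in_past: "j \<le> k \<Longrightarrow> x j \<in> past k"
proof (induction j)
  case 0
  then show ?case
    unfolding past_def using start by (auto intro!: bexI[of _ "\<lambda>_. x0"])
next
  case (Suc j)
  then obtain h where h [measurable]: "h \<in> borel_measurable (Pi\<^sub>M {..<k} (\<lambda>_. P))"
    and x: "\<And>\<omega>. \<omega> \<in> space M \<Longrightarrow> x j \<omega> = h (\<lambda>i\<in>{..<k}. \<xi> i \<omega>)"
    by (auto simp: past_def)
  have [measurable]: "(\<lambda>\<sigma>. \<sigma> j) \<in> measurable (Pi\<^sub>M {..<k} (\<lambda>_. P)) P"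
    using Suc.prems by (intro measurable_component_singleton) auto
  have "(\<lambda>\<sigma>. step j (h \<sigma>) (\<sigma> j)) \<in> borel_measurable (Pi\<^sub>M {..<k} (\<lambda>_. P))"
    using measurable_compose[OF measurable_Pair step_measurable,
        of h "Pi\<^sub>M {..<k} (\<lambda>_. P)" "\<lambda>\<sigma>. \<sigma> j" j] by simp
  moreover have "x (Suc j) \<omega> = step j (h (\<lambda>i\<in>{..<k}. \<xi> i \<omega>)) ((\<lambda>i\<in>{..<k}. \<xi> i \<omega>) j)"
    if "\<omega> \<in> space M" for \<omega>
    using that Suc.prems by (simp add: x_Suc x)
  ultimately show ?case
    unfolding past_def by (auto intro!: bexI[of _ "\<lambda>\<sigma>. step j (h \<sigma>) (\<sigma> j)"])
qed

lemma past_measurable: "z \<in> past k \<Longrightarrow> z \<in> borel_measurable M"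
proof -
  assume "z \<in> past k"
  then obtain h where h [measurable]: "h \<in> borel_measurable (Pi\<^sub>M {..<k} (\<lambda>_. P))"
    and z: "\<And>\<omega>. \<omega> \<in> space M \<Longrightarrow> z \<omega> = h (\<lambda>i\<in>{..<k}. \<xi> i \<omega>)"
    by (auto simp: past_def)
  have "(\<lambda>\<omega>. h (\<lambda>i\<in>{..<k}. \<xi> i \<omega>)) \<in> borel_measurable M"
    by measurable
  then show ?thesis
    using measurable_cong[of M z "\<lambda>\<omega>. h (\<lambda>i\<in>{..<k}. \<xi> i \<omega>)"] z by blast
qed

lemma x_measurable [measurable]: "x k \<in> borel_measurable M"
  using past_measurable[OF x_in_past[OF order_refl]] .

text \<open>The blocks \<open>{..<k}\<close> and \<open>{k}\<close> of the seed sequence are independent, and the pair of random points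
and the seed are images of these blocks.\<close>
lemma joint_law_past_seed:
  assumes "z \<in> past k" "y \<in> past k"
  shows "distr M ((borel \<Otimes>\<^sub>M borel) \<Otimes>\<^sub>M P) (\<lambda>\<omega>. ((z \<omega>, y \<omega>), \<xi> k \<omega>))
    = distr M (borel \<Otimes>\<^sub>M borel) (\<lambda>\<omega>. (z \<omega>, y \<omega>)) \<Otimes>\<^sub>M P"
proof -
  obtain h where h [measurable]: "h \<in> borel_measurable (Pi\<^sub>M {..<k} (\<lambda>_. P))"
    and z: "\<And>\<omega>. \<omega> \<in> space M \<Longrightarrow> z \<omega> = h (\<lambda>i\<in>{..<k}. \<xi> i \<omega>)"
    using assms(1) by (auto simp: past_def)
  obtain h' where h' [measurable]: "h' \<in> borel_measurable (Pi\<^sub>M {..<k} (\<lambda>_. P))"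
    and y: "\<And>\<omega>. \<omega> \<in> space M \<Longrightarrow> y \<omega> = h' (\<lambda>i\<in>{..<k}. \<xi> i \<omega>)"
    using assms(2) by (auto simp: past_def)
  let ?past = "\<lambda>\<omega>. \<lambda>i\<in>{..<k}. \<xi> i \<omega>" and ?now = "\<lambda>\<omega>. \<lambda>i\<in>{k}. \<xi> i \<omega>"
  let ?MA = "Pi\<^sub>M {..<k} (\<lambda>_. P)" and ?MB = "Pi\<^sub>M {k} (\<lambda>_. P)"
  have [measurable]: "(\<lambda>\<sigma>. \<sigma> k) \<in> measurable ?MB P"
    by (rule measurable_component_singleton) simp
  have "indep_var ?MA ?past ?MB ?now"
    using indep_seeds by (rule indep_var_restrict) auto
  then have prod: "distr M ?MA ?past \<Otimes>\<^sub>M distr M ?MB ?now = distr M (?MA \<Otimes>\<^sub>M ?MB) (\<lambda>\<omega>. (?past \<omega>, ?now \<omega>))"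
    unfolding indep_var_distribution_eq by blast
  have seed: "distr (distr M ?MB ?now) P (\<lambda>\<sigma>. \<sigma> k) = P"
    using seed_law[of k] by (simp add: distr_distr comp_def)
  have "distr M (borel \<Otimes>\<^sub>M borel) (\<lambda>\<omega>. (z \<omega>, y \<omega>))
      = distr M (borel \<Otimes>\<^sub>M borel) (\<lambda>\<omega>. (h (?past \<omega>), h' (?past \<omega>)))"
    by (intro distr_cong) (auto simp: z y)
  also have "\<dots> = distr (distr M ?MA ?past) (borel \<Otimes>\<^sub>M borel) (\<lambda>\<sigma>. (h \<sigma>, h' \<sigma>))"
    by (simp add: distr_distr comp_def)
  finally have "distr M (borel \<Otimes>\<^sub>M borel) (\<lambda>\<omega>. (z \<omega>, y \<omega>)) \<Otimes>\<^sub>M P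
      = distr (distr M ?MA ?past) (borel \<Otimes>\<^sub>M borel) (\<lambda>\<sigma>. (h \<sigma>, h' \<sigma>))
        \<Otimes>\<^sub>M distr (distr M ?MB ?now) P (\<lambda>\<sigma>. \<sigma> k)"
    by (simp only: seed)
  also have "\<dots> = distr (distr M ?MA ?past \<Otimes>\<^sub>M distr M ?MB ?now) ((borel \<Otimes>\<^sub>M borel) \<Otimes>\<^sub>M P)
      (\<lambda>(\<sigma>, \<rho>). ((h \<sigma>, h' \<sigma>), \<rho> k))"
    by (rule pair_measure_distr)
      (auto simp: seed intro: seed.sigma_finite_measure_axioms)
  also have "\<dots> = distr M ((borel \<Otimes>\<^sub>M borel) \<Otimes>\<^sub>M P) (\<lambda>\<omega>. ((h (?past \<omega>), h' (?past \<omega>)), \<xi> k \<omega>))"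
    unfolding prod by (subst distr_distr) (auto simp: comp_def)
  also have "\<dots> = distr M ((borel \<Otimes>\<^sub>M borel) \<Otimes>\<^sub>M P) (\<lambda>\<omega>. ((z \<omega>, y \<omega>), \<xi> k \<omega>))"
    by (intro distr_cong) (auto simp: z y)
  finally show ?thesis by simp
qed

text \<open>The bound is an arbitrary integrable \<open>r\<close>, so that one lemma serves the first step, with a
constant \<open>r\<close>, and the general step, where the inner product is replaced by function values.\<close>
lemma expected_step_le:
  assumes "z \<in> past k" and "\<And>\<omega>. \<omega> \<in> space M \<Longrightarrow> z \<omega> \<in> X" and "integrable M r"
    and le: "\<And>\<omega>. \<omega> \<in> space M \<Longrightarrow>
      (1 - \<beta> k) * (norm (x k \<omega> - z \<omega>))\<^sup>2 + \<beta> k * (norm (x0 - z \<omega>))\<^sup>2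
        - 2 * \<tau> k * (mean_grad (x k \<omega>) \<bullet> (x k \<omega> - z \<omega>)) + 3 * (\<tau> k)\<^sup>2 * G\<^sup>2 \<le> r \<omega>"
  shows "integrable M (\<lambda>\<omega>. (norm (x (Suc k) \<omega> - z \<omega>))\<^sup>2)"
    and "expectation (\<lambda>\<omega>. (norm (x (Suc k) \<omega> - z \<omega>))\<^sup>2) \<le> expectation r"
proof -
  define h where "h = (\<lambda>p s. (norm (step k (snd p) s - fst p :: 'a))\<^sup>2)"
  have [measurable]: "(\<lambda>(p, s). h p s) \<in> borel_measurable ((borel \<Otimes>\<^sub>M borel) \<Otimes>\<^sub>M P)"
  proof -
    have [measurable]: "(\<lambda>q :: ('a \<times> 'a) \<times> 's. step k (snd (fst q)) (snd q))
        \<in> borel_measurable ((borel \<Otimes>\<^sub>M borel) \<Otimes>\<^sub>M P)"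
      using measurable_compose[OF measurable_Pair step_measurable,
          of "\<lambda>q. snd (fst q)" "(borel \<Otimes>\<^sub>M borel) \<Otimes>\<^sub>M P" snd k] by simp
    show ?thesis unfolding h_def case_prod_beta' by measurable
  qed
  note fresh = expectation_fresh_seed_le[OF _ seed_measurable seed_law
      joint_law_past_seed[OF assms(1) x_in_past[OF order_refl]] this _ _ _ assms(3)]
  have [measurable]: "z \<in> borel_measurable M"
    using assms(1) by (rule past_measurable)
  have pair: "(\<lambda>\<omega>. (z \<omega>, x k \<omega>)) \<in> measurable M (borel \<Otimes>\<^sub>M borel)"
    by measurable
  have int: "integrable P (h (z \<omega>, x k \<omega>))" if "\<omega> \<in> space M" for \<omega>
    using mean_step(1)[OF assms(2)[OF that]] by (simp add: h_def)
  have bound: "(LINT s|P. h (z \<omega>, x k \<omega>) s) \<le> r \<omega>" if "\<omega> \<in> space M" for \<omega>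
    using order_trans[OF mean_step(2)[OF assms(2)[OF that]] le[OF that]] by (simp add: h_def)
  have eq: "h (z \<omega>, x k \<omega>) (\<xi> k \<omega>) = (norm (x (Suc k) \<omega> - z \<omega>))\<^sup>2" if "\<omega> \<in> space M" for \<omega>
    using that by (simp add: h_def x_Suc)
  have "integrable M (\<lambda>\<omega>. h (z \<omega>, x k \<omega>) (\<xi> k \<omega>))
      \<longleftrightarrow> integrable M (\<lambda>\<omega>. (norm (x (Suc k) \<omega> - z \<omega>))\<^sup>2)"
    by (rule Bochner_Integration.integrable_cong) (simp_all add: eq)
  moreover have "integrable M (\<lambda>\<omega>. h (z \<omega>, x k \<omega>) (\<xi> k \<omega>))"
    by (rule fresh(1)) (auto simp: int bound pair, simp add: h_def)
  ultimately show "integrable M (\<lambda>\<omega>. (norm (x (Suc k) \<omega> - z \<omega>))\<^sup>2)"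
    by blast
  have "expectation (\<lambda>\<omega>. h (z \<omega>, x k \<omega>) (\<xi> k \<omega>))
      = expectation (\<lambda>\<omega>. (norm (x (Suc k) \<omega> - z \<omega>))\<^sup>2)"
    by (rule Bochner_Integration.integral_cong) (simp_all add: eq)
  moreover have "expectation (\<lambda>\<omega>. h (z \<omega>, x k \<omega>) (\<xi> k \<omega>)) \<le> expectation r"
    by (rule fresh(2)) (auto simp: int bound pair, simp add: h_def)
  ultimately show "expectation (\<lambda>\<omega>. (norm (x (Suc k) \<omega> - z \<omega>))\<^sup>2) \<le> expectation r"
    by simp
qed

section \<open>Square integrability and the recursion\<close>
definition \<Phi> :: "('w \<Rightarrow> 'a) \<Rightarrow> real" where
  "\<Phi> z = expectation (\<lambda>\<omega>. (norm (z \<omega> - xstar))\<^sup>2)"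

definition F :: "('w \<Rightarrow> 'a) \<Rightarrow> real" where
  "F z = expectation (\<lambda>\<omega>. f (z \<omega>))"

definition L2 :: "('w \<Rightarrow> 'a) set" where
  "L2 = {z \<in> borel_measurable M. integrable M (\<lambda>\<omega>. (norm (z \<omega>))\<^sup>2)}"

lemma L2_const: "(\<lambda>_. c) \<in> L2"
  by (simp add: L2_def)

lemma integrable_sq_diff:
  assumes "z \<in> L2" "y \<in> L2"
  shows "integrable M (\<lambda>\<omega>. (norm (z \<omega> - y \<omega>))\<^sup>2)"
proof (rule Bochner_Integration.integrable_bound)
  have [measurable]: "z \<in> borel_measurable M" "y \<in> borel_measurable M"
    using assms by (auto simp: L2_def)
  show "(\<lambda>\<omega>. (norm (z \<omega> - y \<omega>))\<^sup>2) \<in> borel_measurable M" by measurable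
  show "integrable M (\<lambda>\<omega>. 2 * (norm (z \<omega>))\<^sup>2 + 2 * (norm (y \<omega>))\<^sup>2)"
    using assms by (simp add: L2_def)
  show "AE \<omega> in M. norm ((norm (z \<omega> - y \<omega>))\<^sup>2) \<le> norm (2 * (norm (z \<omega>))\<^sup>2 + 2 * (norm (y \<omega>))\<^sup>2)"
    using power2_norm_add_le[of "z _" "- y _"] by (intro AE_I2) simp
qed

lemma L2_I:
  assumes "z \<in> borel_measurable M" "y \<in> L2" "integrable M (\<lambda>\<omega>. (norm (z \<omega> - y \<omega>))\<^sup>2)"
  shows "z \<in> L2"
proof -
  note assms(1) [measurable]
  have "integrable M (\<lambda>\<omega>. (norm (z \<omega>))\<^sup>2)"
  proof (rule Bochner_Integration.integrable_bound)
    show "(\<lambda>\<omega>. (norm (z \<omega>))\<^sup>2) \<in> borel_measurable M" by measurable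
    show "integrable M (\<lambda>\<omega>. 2 * (norm (z \<omega> - y \<omega>))\<^sup>2 + 2 * (norm (y \<omega>))\<^sup>2)"
      using assms by (simp add: L2_def)
    show "AE \<omega> in M. norm ((norm (z \<omega>))\<^sup>2) \<le> norm (2 * (norm (z \<omega> - y \<omega>))\<^sup>2 + 2 * (norm (y \<omega>))\<^sup>2)"
    proof (rule AE_I2)
      fix \<omega>
      show "norm ((norm (z \<omega>))\<^sup>2) \<le> norm (2 * (norm (z \<omega> - y \<omega>))\<^sup>2 + 2 * (norm (y \<omega>))\<^sup>2)"
        using power2_norm_add_le[of "z \<omega> - y \<omega>" "y \<omega>"] by simp
    qed
  qed
  then show ?thesis using assms(1) by (simp add: L2_def)
qed

lemma integrable_f:
  assumes "z \<in> L2" shows "integrable M (\<lambda>\<omega>. f (z \<omega>))"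
proof -
  have [measurable]: "z \<in> borel_measurable M"
    using assms by (simp add: L2_def)
  let ?b = "\<lambda>\<omega>. B\<^sup>2 * (norm (z \<omega> - x0))\<^sup>2 + B\<^sup>2 * (norm (xstar - x0))\<^sup>2 + G\<^sup>2 + (norm (z \<omega> - xstar))\<^sup>2"
  have "integrable M (\<lambda>\<omega>. f (z \<omega>) - f xstar)"
  proof (rule Bochner_Integration.integrable_bound)
    show "integrable M ?b"
      using integrable_sq_diff[OF assms L2_const] by simp
    show "AE \<omega> in M. norm (f (z \<omega>) - f xstar) \<le> norm (?b \<omega>)"
      using f_diff_abs_le[of "z _" xstar] by (intro AE_I2) simp
  qed measurable
  then have "integrable M (\<lambda>\<omega>. (f (z \<omega>) - f xstar) + f xstar)"
    by (intro Bochner_Integration.integrable_add) auto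
  then show ?thesis by simp
qed

text \<open>The recursion on which everything rests. The comparison point may be random as long as it is
determined by the past; this is what allows to compare with earlier iterates.\<close>
lemma one_step:
  assumes "z \<in> past k" and z_in: "\<And>\<omega>. \<omega> \<in> space M \<Longrightarrow> z \<omega> \<in> X" and "z \<in> L2" and "x k \<in> L2"
  shows "integrable M (\<lambda>\<omega>. (norm (x (Suc k) \<omega> - z \<omega>))\<^sup>2)"
    and "(real k + 2) * expectation (\<lambda>\<omega>. (norm (x (Suc k) \<omega> - z \<omega>))\<^sup>2)
        + 2 / (sqrt 6 * B) * (sqrt (real k + 1) * (F (x k) - F z))
      \<le> (real k + 1) * expectation (\<lambda>\<omega>. (norm (x k \<omega> - z \<omega>))\<^sup>2)
        + expectation (\<lambda>\<omega>. (norm (x0 - z \<omega>))\<^sup>2) + G\<^sup>2 / (2 * B\<^sup>2)"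
proof -
  define r where "r \<omega> = (1 - \<beta> k) * (norm (x k \<omega> - z \<omega>))\<^sup>2 + \<beta> k * (norm (x0 - z \<omega>))\<^sup>2
        - 2 * \<tau> k * (f (x k \<omega>) - f (z \<omega>)) + 3 * (\<tau> k)\<^sup>2 * G\<^sup>2" for \<omega>
  note [simp] = integrable_sq_diff[OF assms(4,3)] integrable_sq_diff[OF L2_const assms(3)]
    integrable_f[OF assms(3)] integrable_f[OF assms(4)]
  have int_r: "integrable M r"
    unfolding r_def by simp
  have le: "(1 - \<beta> k) * (norm (x k \<omega> - z \<omega>))\<^sup>2 + \<beta> k * (norm (x0 - z \<omega>))\<^sup>2
      - 2 * \<tau> k * (mean_grad (x k \<omega>) \<bullet> (x k \<omega> - z \<omega>)) + 3 * (\<tau> k)\<^sup>2 * G\<^sup>2 \<le> r \<omega>" for \<omega>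
    using mult_left_mono[OF f_diff_le[of "x k \<omega>" "z \<omega>"], of "2 * \<tau> k"] step_sizes[of k]
    by (simp add: r_def)
  note step = expected_step_le[OF assms(1) z_in int_r le]
  show "integrable M (\<lambda>\<omega>. (norm (x (Suc k) \<omega> - z \<omega>))\<^sup>2)"
    by (rule step(1))
  let ?e = "expectation (\<lambda>\<omega>. (norm (x k \<omega> - z \<omega>))\<^sup>2)"
  let ?dist0 = "expectation (\<lambda>\<omega>. (norm (x0 - z \<omega>))\<^sup>2)"
  have "(real k + 2) * expectation (\<lambda>\<omega>. (norm (x (Suc k) \<omega> - z \<omega>))\<^sup>2) \<le> (real k + 2) * expectation r"
    by (intro mult_left_mono step(2)) auto
  also have "expectation r = (1 - \<beta> k) * ?e + \<beta> k * ?dist0 - 2 * \<tau> k * (F (x k) - F z) + 3 * (\<tau> k)\<^sup>2 * G\<^sup>2"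
    unfolding r_def F_def by (simp add: prob_space)
  also have "(real k + 2) * \<dots> = ((real k + 2) * (1 - \<beta> k)) * ?e + ((real k + 2) * \<beta> k) * ?dist0
      - 2 * ((real k + 2) * \<tau> k) * (F (x k) - F z) + (real k + 2) * (3 * (\<tau> k)\<^sup>2 * G\<^sup>2)"
    by (simp add: algebra_simps)
  also have "\<dots> \<le> (real k + 1) * ?e + ?dist0 - 2 / (sqrt 6 * B) * (sqrt (real k + 1) * (F (x k) - F z)) + G\<^sup>2 / (2 * B\<^sup>2)"
    unfolding step_sizes using noise_le[of k] by simp
  finally show "(real k + 2) * expectation (\<lambda>\<omega>. (norm (x (Suc k) \<omega> - z \<omega>))\<^sup>2)
        + 2 / (sqrt 6 * B) * (sqrt (real k + 1) * (F (x k) - F z))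
      \<le> (real k + 1) * ?e + ?dist0 + G\<^sup>2 / (2 * B\<^sup>2)"
    by simp
qed

lemma x_in_L2: "x k \<in> L2"
proof (induction k)
  case 0
  have "integrable M (\<lambda>\<omega>. (norm (x 0 \<omega>))\<^sup>2) \<longleftrightarrow> integrable M (\<lambda>\<omega>. (norm x0)\<^sup>2)"
    by (rule Bochner_Integration.integrable_cong) (auto simp: start)
  then show ?case by (simp add: L2_def)
next
  case (Suc k)
  show ?case
    using one_step(1)[OF const_in_past xstar_in L2_const Suc] x_measurable L2_const
    by (blast intro: L2_I)
qed

lemma F_ge: "0 < k \<Longrightarrow> f xstar \<le> F (x k)"
proof -
  assume "0 < k"
  have "expectation (\<lambda>_. f xstar) \<le> F (x k)"
    unfolding F_def using integrable_f[OF x_in_L2[of k]] xstar_min[OF x_in_X[OF _ \<open>0 < k\<close>]]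
    by (intro integral_mono) auto
  then show ?thesis by (simp add: prob_space)
qed

lemma F_const: "F (\<lambda>_. c) = f c"
  by (simp add: F_def prob_space)

lemma Q_nonneg: "Q \<ge> 0"
  by (simp add: Q_def)

lemma norm_mean_grad_start: "norm (mean_grad x0) \<le> G"
proof (rule power2_le_imp_le)
  show "(norm (mean_grad x0))\<^sup>2 \<le> G\<^sup>2" using mean_grad_sq_le[of x0] by simp
qed (rule G_nonneg)

section \<open>Second moments and telescoped gaps\<close>

text \<open>The recursion with \<open>z = xstar\<close> is of no use at \<open>k = 0\<close>, because \<open>E (f (x 0)) - f xstar\<close> may be negative
when \<open>x0\<close> is not in \<open>X\<close>. Here the inner product is bounded by \<open>G * D\<close> instead, since the mean
gradient at \<open>x0\<close> has norm at most \<open>G\<close>. The slack between \<open>D\<^sup>2\<close> and \<open>Q / 2\<close> covers the loss.\<close>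
lemma first_step: "\<Phi> (x 1) \<le> Q / 2"
proof -
  let ?D = "norm (x0 - xstar)"
  define r where "r = ?D\<^sup>2 - 2 * \<tau> 0 * (mean_grad x0 \<bullet> (x0 - xstar)) + 3 * (\<tau> 0)\<^sup>2 * G\<^sup>2"
  have "\<Phi> (x (Suc 0)) \<le> expectation (\<lambda>_. r)"
    unfolding \<Phi>_def
  proof (rule expected_step_le(2)[OF const_in_past xstar_in])
    fix \<omega> assume "\<omega> \<in> space M"
    then show "(1 - \<beta> 0) * (norm (x 0 \<omega> - xstar))\<^sup>2 + \<beta> 0 * (norm (x0 - xstar))\<^sup>2
        - 2 * \<tau> 0 * (mean_grad (x 0 \<omega>) \<bullet> (x 0 \<omega> - xstar)) + 3 * (\<tau> 0)\<^sup>2 * G\<^sup>2 \<le> r"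
      by (simp add: start r_def algebra_simps)
  qed simp
  also have "\<dots> = r" by (simp add: prob_space)
  finally have "\<Phi> (x 1) \<le> r" by simp
  moreover have "r \<le> ?D\<^sup>2 + 2 * \<tau> 0 * (G * ?D) + 3 * (\<tau> 0)\<^sup>2 * G\<^sup>2"
  proof -
    have "norm (mean_grad x0) * ?D \<le> G * ?D"
      using norm_mean_grad_start by (rule mult_right_mono) simp
    moreover have "- (mean_grad x0 \<bullet> (x0 - xstar)) \<le> norm (mean_grad x0) * ?D"
      using Cauchy_Schwarz_ineq2[of "mean_grad x0" "x0 - xstar"] by linarith
    ultimately have "- (mean_grad x0 \<bullet> (x0 - xstar)) \<le> G * ?D" by linarith
    then have "2 * \<tau> 0 * - (mean_grad x0 \<bullet> (x0 - xstar)) \<le> 2 * \<tau> 0 * (G * ?D)"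
      using step_sizes(3)[of 0] by (intro mult_left_mono) auto
    then show ?thesis unfolding r_def mult_minus_right by linarith
  qed
  moreover have "2 * \<tau> 0 * (G * ?D) \<le> ?D\<^sup>2 / 2 + 2 * (\<tau> 0)\<^sup>2 * G\<^sup>2"
    using sum_squares_bound[of ?D "2 * \<tau> 0 * G"] by (simp add: power_mult_distrib mult_ac)
  moreover define U where "U = G\<^sup>2 / B\<^sup>2"
  moreover have "(\<tau> 0)\<^sup>2 * G\<^sup>2 = U / 24"
    by (simp add: U_def \<tau>_eq power_divide power_mult_distrib)
  moreover have "0 \<le> U" "Q = 3 * ?D\<^sup>2 + U" by (simp_all add: U_def Q_def)
  ultimately show ?thesis
    unfolding mult.assoc by linarith
qed

text \<open>For \<open>k \<ge> 1\<close> the gap is nonnegative and can be dropped. The recursion then exhibits the next moment as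
at most a convex combination, with weights \<open>(k + 1) / (k + 2)\<close> and \<open>1 / (k + 2)\<close>, of the
present one and a constant below \<open>Q / 2\<close>.\<close>
lemma second_moment_le: "0 < k \<Longrightarrow> \<Phi> (x k) \<le> Q / 2"
proof (induction k rule: nat_induct_non_zero)
  case 1
  show ?case by (rule first_step)
next
  case (Suc k)
  have "(real k + 2) * \<Phi> (x (Suc k)) + 2 / (sqrt 6 * B) * (sqrt (real k + 1) * (F (x k) - f xstar))
      \<le> (real k + 1) * \<Phi> (x k) + (norm (x0 - xstar))\<^sup>2 + G\<^sup>2 / (2 * B\<^sup>2)"
    using one_step(2)[OF const_in_past xstar_in L2_const x_in_L2, of k]
    by (simp add: \<Phi>_def F_const prob_space)
  moreover have "0 \<le> 2 / (sqrt 6 * B) * (sqrt (real k + 1) * (F (x k) - f xstar))"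
    using B_pos F_ge[OF \<open>k > 0\<close>] by simp
  moreover have "(real k + 1) * \<Phi> (x k) \<le> (real k + 1) * (Q / 2)"
    using Suc.IH by (intro mult_left_mono) auto
  moreover have "(norm (x0 - xstar))\<^sup>2 + G\<^sup>2 / (2 * B\<^sup>2) \<le> Q / 2"
    by (simp add: Q_def field_simps)
  ultimately have "(real k + 2) * \<Phi> (x (Suc k)) \<le> (real k + 1) * (Q / 2) + Q / 2"
    by linarith
  also have "\<dots> = (real k + 2) * (Q / 2)" by (simp add: algebra_simps)
  finally show ?case
    by (rule mult_left_le_imp_le) simp
qed

text \<open>The term at the upper end stays on the left, to be dropped later; the one at the lower end vanishes
for \<open>z = x j\<close>.\<close>
lemma weighted_gap_sum:
  assumes "\<And>k. j \<le> k \<Longrightarrow> z \<in> past k" and z_in: "\<And>\<omega>. \<omega> \<in> space M \<Longrightarrow> z \<omega> \<in> X"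
    and "z \<in> L2" and "j \<le> n"
  shows "(real n + 1) * expectation (\<lambda>\<omega>. (norm (x n \<omega> - z \<omega>))\<^sup>2)
      + 2 / (sqrt 6 * B) * (\<Sum>k = j..<n. sqrt (real k + 1) * (F (x k) - F z))
    \<le> (real j + 1) * expectation (\<lambda>\<omega>. (norm (x j \<omega> - z \<omega>))\<^sup>2)
      + real (n - j) * (expectation (\<lambda>\<omega>. (norm (x0 - z \<omega>))\<^sup>2) + G\<^sup>2 / (2 * B\<^sup>2))"
  using \<open>j \<le> n\<close>
proof (induction n rule: dec_induct)
  case (step n)
  let ?c = "2 / (sqrt 6 * B)" and ?gap = "\<lambda>k. sqrt (real k + 1) * (F (x k) - F z)"
  let ?R = "expectation (\<lambda>\<omega>. (norm (x0 - z \<omega>))\<^sup>2) + G\<^sup>2 / (2 * B\<^sup>2)"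
  have sum: "?c * sum ?gap {j..<Suc n} = ?c * sum ?gap {j..<n} + ?c * ?gap n"
    by (simp only: sum.atLeastLessThan_Suc[OF step(1)] distrib_left)
  have len: "real (Suc n - j) * ?R = real (n - j) * ?R + ?R"
    using step(1) by (simp add: Suc_diff_le distrib_right)
  have Suc: "real (Suc n) + 1 = real n + 2" by simp
  have add: "p + (s + t) \<le> b + (m + (d + e))" if "a + s \<le> b + m" "p + t \<le> a + d + e"
    for a b d e m p s t :: real
    using that by simp
  show ?case
    unfolding sum len Suc
    by (rule add[OF step.IH one_step(2)[OF assms(1)[OF step(1)] z_in \<open>z \<in> L2\<close> x_in_L2]])
qed simp

text \<open>The boundary term \<open>2 * \<Phi> (x 1) \<le> Q\<close> does not grow with \<open>N\<close> and is absorbed into \<open>N * Q\<close>, the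
driving terms contribute \<open>N * Q / 2\<close>.\<close>
lemma average_gap:
  assumes "N \<ge> 1"
  shows "(\<Sum>k = 1..N. sqrt (real k + 1) * (F (x k) - f xstar))
    \<le> (sqrt 6 * B / 2 * (3 / 2 * Q)) * real N"
proof -
  define S where "S = (\<Sum>k = 1..N. sqrt (real k + 1) * (F (x k) - f xstar))"
  have "(real N + 2) * \<Phi> (x (Suc N)) + 2 / (sqrt 6 * B) * S
      \<le> 2 * \<Phi> (x 1) + real N * ((norm (x0 - xstar))\<^sup>2 + G\<^sup>2 / (2 * B\<^sup>2))"
    using weighted_gap_sum[of 1 "\<lambda>_. xstar" "Suc N", OF const_in_past xstar_in L2_const] assms
    by (simp add: S_def \<Phi>_def F_const prob_space atLeastLessThanSuc_atLeastAtMost add_ac)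
  moreover have "0 \<le> (real N + 2) * \<Phi> (x (Suc N))"
    by (simp add: \<Phi>_def)
  moreover have "real N * ((norm (x0 - xstar))\<^sup>2 + G\<^sup>2 / (2 * B\<^sup>2)) \<le> real N * (Q / 2)"
    by (intro mult_left_mono) (simp_all add: Q_def field_simps)
  moreover have "2 * \<Phi> (x 1) \<le> real N * Q"
    using first_step mult_right_mono[of 1 "real N" Q] assms Q_nonneg by simp
  ultimately have "2 / (sqrt 6 * B) * S \<le> real N * Q + real N * (Q / 2)"
    by linarith
  also have "\<dots> = 3 / 2 * Q * real N" by simp
  finally have "2 / (sqrt 6 * B) * S \<le> 3 / 2 * Q * real N" .
  then have "S \<le> (sqrt 6 * B / 2 * (3 / 2 * Q)) * real N"
    using B_pos by (simp add: field_simps)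
  then show ?thesis by (simp only: S_def)
qed

text \<open>Apart from the noise, only the distance of \<open>x j\<close> from the anchor is left on the right; it is controlled
through \<open>xstar\<close> by the uniform bound on second moments.\<close>
lemma suffix_gap:
  assumes "1 \<le> j" "j \<le> N"
  shows "(\<Sum>k = j..N. sqrt (real k + 1) * (F (x k) - F (x j)))
    \<le> (sqrt 6 * B / 2 * (5 / 3 * Q)) * real (N + 1 - j)"
proof -
  define S where "S = (\<Sum>k = j..N. sqrt (real k + 1) * (F (x k) - F (x j)))"
  let ?dist0 = "expectation (\<lambda>\<omega>. (norm (x0 - x j \<omega>))\<^sup>2)"
  have "j > 0" using assms by simp
  have "?dist0 \<le> expectation (\<lambda>\<omega>. 2 * (norm (x0 - xstar))\<^sup>2 + 2 * (norm (x j \<omega> - xstar))\<^sup>2)"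
  proof (rule integral_mono)
    show "(norm (x0 - x j \<omega>))\<^sup>2 \<le> 2 * (norm (x0 - xstar))\<^sup>2 + 2 * (norm (x j \<omega> - xstar))\<^sup>2" for \<omega>
      using power2_norm_add_le[of "x0 - xstar" "xstar - x j \<omega>"] by (simp add: norm_minus_commute)
  qed (simp_all add: integrable_sq_diff x_in_L2 L2_const)
  also have "\<dots> = 2 * (norm (x0 - xstar))\<^sup>2 + 2 * \<Phi> (x j)"
    by (simp add: \<Phi>_def prob_space integrable_sq_diff x_in_L2 L2_const)
  finally have e0: "?dist0 + G\<^sup>2 / (2 * B\<^sup>2) \<le> 5 / 3 * Q"
  proof -
    assume "?dist0 \<le> 2 * (norm (x0 - xstar))\<^sup>2 + 2 * \<Phi> (x j)"
    moreover have "2 * (norm (x0 - xstar))\<^sup>2 + G\<^sup>2 / (2 * B\<^sup>2) \<le> 2 / 3 * Q"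
    proof -
      define U where "U = G\<^sup>2 / B\<^sup>2"
      have "G\<^sup>2 / (2 * B\<^sup>2) = U / 2" "0 \<le> U" "Q = 3 * (norm (x0 - xstar))\<^sup>2 + U"
        by (simp_all add: U_def Q_def)
      then show ?thesis by linarith
    qed
    ultimately show ?thesis
      using second_moment_le[OF \<open>j > 0\<close>] by linarith
  qed
  have "(real N + 2) * expectation (\<lambda>\<omega>. (norm (x (Suc N) \<omega> - x j \<omega>))\<^sup>2) + 2 / (sqrt 6 * B) * S
      \<le> real (N + 1 - j) * (?dist0 + G\<^sup>2 / (2 * B\<^sup>2))"
    using weighted_gap_sum[of j "x j" "Suc N", OF x_in_past x_in_X[OF _ \<open>j > 0\<close>] x_in_L2] assms
    by (simp add: S_def atLeastLessThanSuc_atLeastAtMost add_ac)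
  moreover have "0 \<le> (real N + 2) * expectation (\<lambda>\<omega>. (norm (x (Suc N) \<omega> - x j \<omega>))\<^sup>2)"
    by simp
  moreover have "real (N + 1 - j) * (?dist0 + G\<^sup>2 / (2 * B\<^sup>2)) \<le> real (N + 1 - j) * (5 / 3 * Q)"
    using e0 by (rule mult_left_mono) simp
  ultimately have "2 / (sqrt 6 * B) * S \<le> 5 / 3 * Q * real (N + 1 - j)"
    by (simp only: mult.commute[of "5 / 3 * Q"])
  then have "S \<le> (sqrt 6 * B / 2 * (5 / 3 * Q)) * real (N + 1 - j)"
    using B_pos by (simp add: field_simps)
  then show ?thesis by (simp only: S_def)
qed

section \<open>The rate\<close>

text \<open>No iteration has taken place, so this is convexity alone: the gap is at most \<open>G * D\<close>, which is
\<open>B\<close> times the product of \<open>G / B\<close> and \<open>D\<close>.\<close>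
lemma initial_gap: "F (x 0) - f xstar \<le> sqrt 6 * B * Q"
proof -
  let ?D = "norm (x0 - xstar)"
  have "F (x 0) = expectation (\<lambda>_. f x0)"
    unfolding F_def by (rule Bochner_Integration.integral_cong) (auto simp: start)
  then have "F (x 0) - f xstar \<le> mean_grad x0 \<bullet> (x0 - xstar)"
    using f_diff_le[of x0 xstar] by (simp add: prob_space)
  also have "\<dots> \<le> norm (mean_grad x0) * ?D"
    by (rule norm_cauchy_schwarz)
  also have "\<dots> \<le> G * ?D"
    using norm_mean_grad_start by (rule mult_right_mono) simp
  also have "\<dots> = B * (G / B * ?D)" using B_pos by simp
  also have "G / B * ?D \<le> ((G / B)\<^sup>2 + ?D\<^sup>2) / 2"
    using sum_squares_bound[of "G / B" ?D] by (simp add: mult_ac)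
  also have "\<dots> \<le> Q"
  proof -
    have "Q = 3 * ?D\<^sup>2 + (G / B)\<^sup>2" by (simp add: Q_def power_divide)
    moreover have "(u + v) / 2 \<le> 3 * v + u" if "0 \<le> u" "0 \<le> v" for u v :: real
      using that by simp
    ultimately show ?thesis by simp
  qed
  also have "B * Q \<le> sqrt 6 * (B * Q)"
    using B_pos Q_nonneg mult_right_mono[of 1 "sqrt 6" "B * Q"] by simp
  finally show ?thesis using B_pos by (simp add: mult_ac)
qed

text \<open>The averaging argument yields the factor \<open>9 / 8 + 5 / 4 * harm (N - 1)\<close> in front of
\<open>sqrt 6 * B * Q\<close>. Since \<open>harm (N - 1) \<le> 1 + L\<close> with \<open>L = ln (N + 2)\<close>, it is at most
\<open>2 * (1 + L)\<close> as soon as \<open>L \<ge> 1 / 2\<close>.\<close>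
lemma last_iterate_bound:
  "F (x N) - f xstar \<le> 2 * sqrt 6 * B * (1 + ln (real N + 2)) / sqrt (real N + 1) * Q"
proof -
  have half: "1 / 2 \<le> ln (real N + 2)"
  proof -
    have "ln 2 \<le> ln (real N + 2)" by simp
    then show ?thesis using ln2_ge_two_thirds by linarith
  qed
  have C_nonneg: "0 \<le> sqrt 6 * B * Q"
    using B_pos Q_nonneg by simp
  show ?thesis
  proof (cases "N = 0")
    case True
    have "F (x 0) - f xstar \<le> (sqrt 6 * B * Q) * 1"
      using initial_gap by simp
    also have "\<dots> \<le> (sqrt 6 * B * Q) * (2 * (1 + ln (real N + 2)))"
      using half C_nonneg by (intro mult_left_mono) auto
    finally show ?thesis using True by (simp add: algebra_simps)
  next
    case False
    have harm: "harm (N - 1) \<le> 1 + ln (real N + 2)"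
    proof (cases "N = 1")
      case True
      then show ?thesis using half by (simp add: harm_def)
    next
      case False
      then have "harm (N - 1) \<le> 1 + ln (real (N - 1))"
        using \<open>N \<noteq> 0\<close> by (intro harm_le_one_plus_ln) simp
      also have "ln (real (N - 1)) \<le> ln (real N + 2)"
        using False \<open>N \<noteq> 0\<close> by (intro ln_mono) auto
      finally show ?thesis by simp
    qed
    let ?C = "sqrt 6 * B / 2"
    have "F (x N) - f xstar
        \<le> 3 / 2 * (?C * (3 / 2 * Q) + ?C * (5 / 3 * Q) * harm (N - 1)) / sqrt (real N + 1)"
      using last_iterate_from_suffix_sums[of N "?C * (3 / 2 * Q)" "?C * (5 / 3 * Q)" "\<lambda>k. F (x k) - f xstar"]
        average_gap[of N] suffix_gap[of _ N] False B_pos Q_nonneg by simp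
    also have "\<dots> = (sqrt 6 * B * Q) * (9 / 8 + 5 / 4 * harm (N - 1)) / sqrt (real N + 1)"
      by (simp add: algebra_simps)
    also have "\<dots> \<le> (sqrt 6 * B * Q) * (2 * (1 + ln (real N + 2))) / sqrt (real N + 1)"
      using harm half C_nonneg by (intro divide_right_mono mult_left_mono) auto
    finally show ?thesis by (simp add: algebra_simps)
  qed
qed

end

text \<open>A single power of the logarithm suffices.\<close>
lemma rate_in_soft_bigo:
  "(\<lambda>k. c * (1 + ln (real k + 2)) / sqrt (real k + 1) * q) \<in> soft_bigo (\<lambda>k. 1 / sqrt (real k))"
proof -
  have "(\<lambda>k::nat. (1 + ln (real k + 2)) / sqrt (real k + 1)) \<in> O(\<lambda>k. ln (real k) ^ 1 * (1 / sqrt (real k)))"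
    by real_asymp
  then have "(\<lambda>k::nat. (c * q) * ((1 + ln (real k + 2)) / sqrt (real k + 1)))
      \<in> O(\<lambda>k. ln (real k) ^ 1 * (1 / sqrt (real k)))"
    by (simp only: cmult_in_bigo_iff simp_thms)
  also have "(\<lambda>k::nat. (c * q) * ((1 + ln (real k + 2)) / sqrt (real k + 1)))
      = (\<lambda>k. c * (1 + ln (real k + 2)) / sqrt (real k + 1) * q)"
    by (rule ext) simp
  finally show ?thesis
    unfolding soft_bigo_def by blast
qed

theorem theorem3p6:
  fixes X :: "'a::euclidean_space set"
    and f :: "'a \<Rightarrow> real"
    and x0 xstar :: 'a
    and B G :: real
    and P :: "'s measure"
    and g :: "'a \<Rightarrow> 's \<Rightarrow> 'a"
    and M :: "'w measure"
    and \<xi> :: "nat \<Rightarrow> 'w \<Rightarrow> 's"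
    and x :: "nat \<Rightarrow> 'w \<Rightarrow> 'a"
    and \<beta> \<tau> :: "nat \<Rightarrow> real"
  assumes "X \<noteq> {}" and "closed X" and "convex X"
    and "convex_on UNIV f"
    and "xstar \<in> X" and "\<forall>y\<in>X. f xstar \<le> f y"
    and "B > 0" and "G \<ge> 0"
    and "stochastic_subgradient_oracle f x0 B G P g"
    and "prob_space M"
    and "prob_space.indep_vars M (\<lambda>_. P) \<xi> UNIV"
    and "\<forall>k. distr M P (\<xi> k) = P"
    and "\<forall>k. \<beta> k = 1 / (real k + 2)"
    and "\<forall>k. \<tau> k = sqrt (real k + 1) / (sqrt 6 * B * (real k + 2))"
    and "\<forall>\<omega>\<in>space M. x 0 \<omega> = x0"
    and "\<forall>k. \<forall>\<omega>\<in>space M. x (Suc k) \<omega> =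
           closest_point X (\<beta> k *\<^sub>R x0 + (1 - \<beta> k) *\<^sub>R x k \<omega> - \<tau> k *\<^sub>R g (x k \<omega>) (\<xi> k \<omega>))"
  shows "(\<forall>k. integrable M (\<lambda>\<omega>. f (x k \<omega>)) \<and>
            (LINT \<omega>|M. f (x k \<omega>)) - f xstar
              \<le> 2 * sqrt 6 * B * (1 + ln (real k + 2)) / sqrt (real k + 1)
                  * (3 * (norm (x0 - xstar))\<^sup>2 + G\<^sup>2 / B\<^sup>2))
       \<and> (\<lambda>k. 2 * sqrt 6 * B * (1 + ln (real k + 2)) / sqrt (real k + 1)
                  * (3 * (norm (x0 - xstar))\<^sup>2 + G\<^sup>2 / B\<^sup>2))
           \<in> soft_bigo (\<lambda>k. 1 / sqrt (real k))"
proof -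
  interpret stochastic_halpern M X f x0 xstar B G P g \<xi> x \<beta> \<tau>
    using assms by (intro stochastic_halpern.intro stochastic_halpern_axioms.intro) auto
  show ?thesis
    using integrable_f[OF x_in_L2] last_iterate_bound rate_in_soft_bigo
    unfolding F_def Q_def by blast
qed

end
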